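(* Let $k\ge 2$ and $m>0$ be integers. If $m$ admits an ordered minimal Markoff $m$-triple with $k$-Fibonacci components, then this triple is unique, except precisely for $k=3$ and the pairs of triples $(F_3(a),F_3(b),F_3(a+b))$, $(F_3(a+1),F_3(b-1),F_3(a+b))$ with $a\geq 1$ odd, $b$ even and $b\ge a+3$. That is: (i) if there are two distinct ordered minimal Markoff $m$-triples with $k$-Fibonacci components (for the same $k$ and $m$), then $k=3$ and there exist an odd integer $a\ge 1$ and an even integer $b\ge a+3$ such that the two triples are $(F_3(a),F_3(b),F_3(a+b))$ and $(F_3(a+1),F_3(b-1),F_3(a+b))$; (ii) for every odd integer $a\ge 1$ and every even integer $b\ge a+3$, the triples $(F_3(a),F_3(b),F_3(a+b))$ and $(F_3(a+1),F_3(b-1),F_3(a+b))$ are distinct ordered minimal Markoff $m$-triples for one and the same integer $m>0$.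
   Context: For a positive integer $k$, the $k$-Fibonacci numbers are defined by $F_k(0)=0$, $F_k(1)=1$ and $F_k(n)=kF_k(n-1)+F_k(n-2)$ for $n\ge 2$. For a positive integer $m$, a Markoff $m$-triple is a triple $(x,y,z)$ of positive integers satisfying $x^2+y^2+z^2=3xyz+m$. It is ordered if $x\le y\le z$. An ordered Markoff $m$-triple is minimal if $z\ge 3xy$. A Markoff $m$-triple has $k$-Fibonacci components if $(x,y,z)=(F_k(a),F_k(b),F_k(c))$ for some positive integers $a,b,c$. *)

theory Defs
  imports Main
begin

fun kfib :: "int \<Rightarrow> nat \<Rightarrow> int" where
  "kfib k 0 = 0"
| "kfib k (Suc 0) = 1"
| "kfib k (Suc (Suc n)) = k * kfib k (Suc n) + kfib k n"

definition markoff_triple :: "int \<Rightarrow> int \<times> int \<times> int \<Rightarrow> bool" where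
  "markoff_triple m = (\<lambda>(x, y, z). x > 0 \<and> y > 0 \<and> z > 0 \<and>
     x\<^sup>2 + y\<^sup>2 + z\<^sup>2 = 3 * x * y * z + m)"

definition ordered_markoff_triple :: "int \<Rightarrow> int \<times> int \<times> int \<Rightarrow> bool" where
  "ordered_markoff_triple m = (\<lambda>(x, y, z). markoff_triple m (x, y, z) \<and> x \<le> y \<and> y \<le> z)"

definition minimal_markoff_triple :: "int \<Rightarrow> int \<times> int \<times> int \<Rightarrow> bool" where
  "minimal_markoff_triple m = (\<lambda>(x, y, z). ordered_markoff_triple m (x, y, z) \<and> z \<ge> 3 * x * y)"

definition kfib_components :: "int \<Rightarrow> int \<times> int \<times> int \<Rightarrow> bool" where
  "kfib_components k T \<longleftrightarrow>
     (\<exists>a b c. a > 0 \<and> b > 0 \<and> c > 0 \<and> T = (kfib k a, kfib k b, kfib k c))"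

end

(*
  Write F = F_k and M(x,y,z) = x^2 + y^2 + z^2 - 3xyz.  For a minimal triple (F a, F b, F c) one has
  a + b <= c, and F(c-1)^2 <= M < F(c)^2, the only failure of the lower bound being k = 2 and the
  triple (2,2,12).  Hence m determines c.  If two triples share z = F c and xy > x'y', then
  3z(xy - x'y') = x^2 + y^2 - x'^2 - y'^2, and comparing sizes yields a' + b' = a + b and c = a + b.
  With a' = a + t and b' = a + d, Vajda's identity shows that a is odd and xy - x'y' = F t * F d.
  If b - a is even, then F c divides 2(x'^2 - x^2), which lies strictly between 0 and F c.
  If b - a is odd, dividing by F c leaves 3 * F t * F d = F(d+t) - F(d-t), which forces
  k = 3 and t = 1.
*)
theory Submission
  imports Defs
begin

section \<open>Identities for k-Fibonacci numbers\<close>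

lemma kfib_add:
  "kfib k (Suc (m + n)) = kfib k (Suc m) * kfib k (Suc n) + kfib k m * kfib k n"
proof (induction m arbitrary: n)
  case (Suc m)
  show ?case using Suc[of "Suc n"] by (simp add: algebra_simps)
qed simp

text \<open>Isolates the term k*xy in F(a+b), with x = F(a) and y = F(b), so that F(a+b) can be
  compared with 3xy.\<close>

lemma kfib_add_Suc:
  "kfib k (Suc (Suc (m + n))) =
     k * kfib k (Suc m) * kfib k (Suc n) + kfib k (Suc m) * kfib k n + kfib k m * kfib k (Suc n)"
  using kfib_add[of k "Suc m" n] by (simp add: algebra_simps)

lemma kfib_Cassini: "(kfib k (Suc n))\<^sup>2 - kfib k n * kfib k (Suc (Suc n)) = (-1) ^ n"
  by (induction n) (simp_all add: power2_eq_square algebra_simps)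

text \<open>Both sides obey the k-Fibonacci recurrence in \<open>j\<close>; they vanish at
  \<open>j = 0\<close>, and \<open>j = 1\<close> is Cassini's identity.\<close>

lemma kfib_dOcagne:
  "kfib k (Suc n) * kfib k (n + j) - kfib k n * kfib k (Suc (n + j)) = (-1) ^ n * kfib k j"
proof (induction k j rule: kfib.induct)
  case (2 k)
  then show ?case using kfib_Cassini[of k n] by (simp add: power2_eq_square)
next
  case (3 k j)
  have "kfib k (Suc n) * kfib k (n + Suc (Suc j)) - kfib k n * kfib k (Suc (n + Suc (Suc j))) =
     k * (kfib k (Suc n) * kfib k (n + Suc j) - kfib k n * kfib k (Suc (n + Suc j))) +
     (kfib k (Suc n) * kfib k (n + j) - kfib k n * kfib k (Suc (n + j)))"
    by (simp add: algebra_simps)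
  then show ?case using 3 by (simp add: algebra_simps)
qed simp

text \<open>The same argument in \<open>i\<close>: both sides obey the recurrence, and
  \<open>i = 1\<close> is d'Ocagne's identity.\<close>

lemma kfib_Vajda:
  "kfib k (n + i) * kfib k (n + j) - kfib k n * kfib k (n + i + j) = (-1) ^ n * kfib k i * kfib k j"
proof (induction k i rule: kfib.induct)
  case (2 k)
  then show ?case using kfib_dOcagne[of k n j] by simp
next
  case (3 k i)
  have "kfib k (n + Suc (Suc i)) * kfib k (n + j) - kfib k n * kfib k (n + Suc (Suc i) + j) =
     k * (kfib k (n + Suc i) * kfib k (n + j) - kfib k n * kfib k (n + Suc i + j)) +
     (kfib k (n + i) * kfib k (n + j) - kfib k n * kfib k (n + i + j))"
    by (simp add: algebra_simps)
  then show ?case using 3 by (simp add: algebra_simps)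
qed simp

text \<open>Vajda's identity based at \<open>e\<close> with both shifts equal to \<open>a\<close>;
  the parity of \<open>e\<close> decides the sign of the square of F(a).\<close>

lemma kfib_sum_of_squares:
  assumes "odd e"
  shows "(kfib k a)\<^sup>2 + (kfib k (a + e))\<^sup>2 = kfib k e * kfib k (2 * a + e)"
  using kfib_Vajda[of k e a a] assms by (simp add: power2_eq_square add_ac mult_2)

lemma kfib_diff_of_squares:
  assumes "even e"
  shows "(kfib k (a + e))\<^sup>2 - (kfib k a)\<^sup>2 = kfib k e * kfib k (2 * a + e)"
  using kfib_Vajda[of k e a a] assms by (simp add: power2_eq_square add_ac mult_2)

text \<open>Put t = \<open>Suc r\<close>. The addition formula expands F(n+2t) and d'Ocagne expands
  F(n) in terms of F(n+t) and F(n+t+1). For odd t the terms F(t)F(n+t+1) cancel; for even t, in the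
  next lemma, they add up and F(t) factors out.\<close>

lemma kfib_shift_odd:
  assumes "odd (Suc r)"
  shows "kfib k (n + 2 * Suc r) - kfib k n =
    kfib k (n + Suc r) * (kfib k (Suc (Suc r)) + kfib k r)"
proof -
  have "kfib k (n + 2 * Suc r) =
      kfib k (Suc r) * kfib k (Suc (n + Suc r)) + kfib k r * kfib k (n + Suc r)"
    using kfib_add[of k r "n + Suc r"] by (simp add: algebra_simps mult_2_right del: kfib.simps)
  with kfib_dOcagne[of k "Suc r" n] assms show ?thesis
    by (simp add: algebra_simps mult_2_right del: kfib.simps)
qed

lemma kfib_shift_even:
  assumes "even t"
  shows "kfib k (n + 2 * t) - kfib k n =
    kfib k t * (2 * kfib k (Suc (n + t)) - k * kfib k (n + t))"
proof (cases t)
  case (Suc r)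
  have "kfib k (n + 2 * Suc r) =
      kfib k (Suc r) * kfib k (Suc (n + Suc r)) + kfib k r * kfib k (n + Suc r)"
    using kfib_add[of k r "n + Suc r"] by (simp add: algebra_simps mult_2_right del: kfib.simps)
  moreover have "kfib k (Suc (Suc r)) = k * kfib k (Suc r) + kfib k r" by simp
  ultimately show ?thesis using kfib_dOcagne[of k "Suc r" n] assms Suc
    by (simp add: algebra_simps mult_2_right del: kfib.simps)
qed simp

section \<open>Growth and product estimates\<close>

lemma kfib_pos: "k \<ge> 2 \<Longrightarrow> kfib k (Suc n) > 0" and kfib_nonneg: "k \<ge> 2 \<Longrightarrow> kfib k n \<ge> 0"
proof -
  have "k \<ge> 2 \<Longrightarrow> kfib k (Suc n) > 0 \<and> kfib k n \<ge> 0" for n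
    by (induction n) (auto intro: add_pos_nonneg)
  then show "k \<ge> 2 \<Longrightarrow> kfib k (Suc n) > 0" "k \<ge> 2 \<Longrightarrow> kfib k n \<ge> 0" by auto
qed

lemma kfib_double:
  assumes "k \<ge> 2"
  shows "2 * kfib k n \<le> kfib k (Suc n)"
proof (cases n)
  case (Suc r)
  have "2 * kfib k (Suc r) \<le> k * kfib k (Suc r)"
    using kfib_pos[OF assms, of r] assms by (intro mult_right_mono) auto
  then show ?thesis using kfib_nonneg[OF assms, of r] Suc by simp
qed simp

lemma kfib_mult_le:
  assumes "k \<ge> 2"
  shows "k * kfib k n \<le> kfib k (Suc n)"
  using kfib_nonneg[OF assms] by (cases n) auto

lemma strict_mono_kfib:
  assumes "k \<ge> 2"
  shows "strict_mono (kfib k)"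
proof (rule strict_mono_Suc_iff[THEN iffD2], rule allI)
  fix n
  show "kfib k n < kfib k (Suc n)"
    using kfib_double[OF assms, of n] kfib_nonneg[OF assms, of n] kfib_pos[OF assms, of n] by linarith
qed

lemma kfib_less_iff [simp]: "k \<ge> 2 \<Longrightarrow> kfib k m < kfib k n \<longleftrightarrow> m < n"
  and kfib_le_iff [simp]: "k \<ge> 2 \<Longrightarrow> kfib k m \<le> kfib k n \<longleftrightarrow> m \<le> n"
  and kfib_eq_iff [simp]: "k \<ge> 2 \<Longrightarrow> kfib k m = kfib k n \<longleftrightarrow> m = n"
  by (simp_all add: strict_mono_kfib strict_mono_less strict_mono_less_eq strict_mono_eq)

lemma kfib_mult_le_add:
  assumes "k \<ge> 2"
  shows "kfib k (Suc m) * kfib k (Suc n) \<le> kfib k (Suc (m + n))"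
  using kfib_add[of k m n] kfib_nonneg[OF assms] by simp

text \<open>Doubling bounds F(m)F(n) by a quarter of F(m+1)F(n+1). With
  \<open>kfib_mult_le_add\<close> this fixes F(m+n+1) up to a factor 5/4, the precision behind the
  later size comparisons.\<close>

lemma kfib_add_le_mult:
  assumes "k \<ge> 2"
  shows "4 * kfib k (Suc (m + n)) \<le> 5 * (kfib k (Suc m) * kfib k (Suc n))"
proof -
  have "(2 * kfib k m) * (2 * kfib k n) \<le> kfib k (Suc m) * kfib k (Suc n)"
    using kfib_double[OF assms] kfib_nonneg[OF assms] by (intro mult_mono) auto
  then show ?thesis using kfib_add[of k m n] by simp
qed

section \<open>Bounds for m in terms of the largest component\<close>

text \<open>Since F(p+q+1) is at most 5/4 of the product, it lies below three times the product. For
  a = p+1 and b = q+1 the conclusion reads a + b <= c.\<close>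

lemma minimal_index_ge:
  assumes "k \<ge> 2" and "3 * kfib k (Suc p) * kfib k (Suc q) \<le> kfib k c"
  shows "Suc (Suc (p + q)) \<le> c"
proof (rule ccontr)
  assume "\<not> ?thesis"
  then have "c \<le> Suc (p + q)" by simp
  then have "kfib k c \<le> kfib k (Suc (p + q))" using assms(1) by simp
  moreover have "kfib k (Suc p) * kfib k (Suc q) > 0" using kfib_pos[OF assms(1)] by simp
  ultimately show False using kfib_add_le_mult[OF assms(1), of p q] assms(2) by simp
qed

lemma kfib_double_eqD:
  assumes k: "k \<ge> 2" and eq: "2 * kfib k n = kfib k (Suc n)"
  shows "k = 2 \<and> n = 1"
proof (cases n)
  case (Suc r)
  have pos: "0 < kfib k (Suc r)" "0 \<le> kfib k r"
    using kfib_pos[OF k] kfib_nonneg[OF k] by auto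
  have "2 * kfib k (Suc r) \<le> k * kfib k (Suc r)" using k pos by (intro mult_right_mono) auto
  moreover have "2 * kfib k (Suc r) = k * kfib k (Suc r) + kfib k r" using eq Suc by simp
  ultimately have "2 * kfib k (Suc r) = k * kfib k (Suc r)" "kfib k r = 0" using pos by linarith+
  then have "k = 2" "kfib k r = kfib k 0" using pos by auto
  then show ?thesis using Suc k by (simp del: kfib.simps)
qed (use eq in simp)

text \<open>Both squares are at most yz, and 2yz < 3yz <= 3xyz.\<close>

lemma markoff_less_square:
  fixes x y z :: int
  assumes "0 < x" "x \<le> y" "y \<le> z"
  shows "x\<^sup>2 + y\<^sup>2 + z\<^sup>2 - 3 * x * y * z < z\<^sup>2"
proof -
  have "x\<^sup>2 \<le> y\<^sup>2" using assms by (intro power_mono) auto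
  moreover have "y\<^sup>2 \<le> y * z" using assms by (simp add: power2_eq_square)
  moreover have "1 * (y * z) \<le> x * (y * z)" using assms by (intro mult_right_mono) auto
  moreover have "0 < y * z" using assms by simp
  ultimately show ?thesis by (simp add: algebra_simps)
qed

text \<open>For k = 2 the expansion of F(a+b) turns minimality into xy <= xv + uy. Doubling bounds
  each summand by xy/2, so equality holds in both doublings.\<close>

lemma minimal_exception:
  assumes "p \<le> q"
    and "3 * kfib 2 (Suc p) * kfib 2 (Suc q) \<le> kfib 2 (Suc (Suc (p + q)))"
  shows "p = 1 \<and> q = 1"
proof -
  let ?u = "kfib 2 p" and ?x = "kfib 2 (Suc p)" and ?v = "kfib 2 q" and ?y = "kfib 2 (Suc q)"
  have pos: "0 < ?x" "0 < ?y" using kfib_pos[of 2] by auto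
  have "?x * ?y \<le> ?x * ?v + ?u * ?y" using assms(2) kfib_add_Suc[of 2 p q] by simp
  moreover have "?x * (2 * ?v) \<le> ?x * ?y" "(2 * ?u) * ?y \<le> ?x * ?y"
    using kfib_double[of 2] pos by (auto intro: mult_left_mono mult_right_mono)
  ultimately have "?x * (2 * ?v) = ?x * ?y" "(2 * ?u) * ?y = ?x * ?y" by linarith+
  then have "2 * ?v = ?y" "2 * ?u = ?x" using pos by auto
  then show ?thesis using kfib_double_eqD[of 2] by auto
qed

text \<open>The value is x^2 + y^2 + z(z - 3xy), so the matter is to bound the gap z - 3xy from
  below. The excluded case is the triple (2,2,12), whose value 8 is below 5^2.\<close>

lemma markoff_ge_square:
  assumes k: "k \<ge> 2" and pq: "p \<le> q"
    and min: "3 * kfib k (Suc p) * kfib k (Suc q) \<le> kfib k (Suc n)"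
    and nexc: "\<not> (k = 2 \<and> p = 1 \<and> q = 1 \<and> n = 3)"
  shows "(kfib k n)\<^sup>2 \<le> (kfib k (Suc p))\<^sup>2 + (kfib k (Suc q))\<^sup>2 + (kfib k (Suc n))\<^sup>2
    - 3 * kfib k (Suc p) * kfib k (Suc q) * kfib k (Suc n)"
proof -
  let ?u = "kfib k p" and ?x = "kfib k (Suc p)" and ?v = "kfib k q" and ?y = "kfib k (Suc q)"
  let ?z = "kfib k (Suc n)" and ?w = "kfib k n"
  have pos: "0 < ?x" "0 < ?y" "0 < ?z" "0 \<le> ?w" "0 \<le> ?u" "0 \<le> ?v"
    using kfib_pos[OF k] kfib_nonneg[OF k] by auto
  have xy: "0 < ?x * ?y" using pos by simp
  have M: "?x\<^sup>2 + ?y\<^sup>2 + ?z\<^sup>2 - 3 * ?x * ?y * ?z = ?x\<^sup>2 + ?y\<^sup>2 + ?z * (?z - 3 * ?x * ?y)"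
    by (simp add: power2_eq_square algebra_simps)
  have n: "Suc (p + q) \<le> n" using minimal_index_ge[OF k min] by simp
  show ?thesis
  proof (cases "n = Suc (p + q)")
    \<comment> \<open>Here xy <= F(r) with n = r+1, so z - 3xy >= 2w + F(r) - 3F(r) >= w by
      doubling, and the product z(z - 3xy) alone reaches w^2.\<close>
    case False
    then obtain r where r: "n = Suc r" "Suc (p + q) \<le> r" using n by (cases n) auto
    have "?x * ?y \<le> kfib k r"
      using kfib_mult_le_add[OF k, of p q] r k by (meson kfib_le_iff order_trans)
    moreover have "2 * kfib k r \<le> ?w" using kfib_double[OF k, of r] r by simp
    moreover have "2 * ?w \<le> k * ?w" using k pos by (intro mult_right_mono) auto
    moreover have "?z = k * ?w + kfib k r" using r by simp
    ultimately have "?w \<le> ?z - 3 * ?x * ?y" "?w \<le> ?z" using pos xy unfolding mult.assoc by linarith+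
    then have "?w * ?w \<le> ?z * (?z - 3 * ?x * ?y)" using pos by (intro mult_mono) auto
    moreover have "0 \<le> ?x\<^sup>2" "0 \<le> ?y\<^sup>2" by simp_all
    ultimately show ?thesis unfolding M power2_eq_square[of ?w] by linarith
  next
    case True
    have k3: "k \<ge> 3"
    proof (rule ccontr)
      assume "\<not> k \<ge> 3"
      then have "k = 2" using k by simp
      then show False using minimal_exception[OF pq] min True nexc by (auto simp del: kfib.simps)
    qed
    have w: "?w = ?x * ?y + ?u * ?v" using True kfib_add[of k p q] by simp
    have z: "?z = k * ?x * ?y + ?x * ?v + ?u * ?y" using True kfib_add_Suc[of k p q] by simp
    \<comment> \<open>For \<open>p = 0\<close> the gap may be small, but then w = y and the square
      of y suffices. Otherwise both squares are dropped.\<close>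
    show ?thesis
    proof (cases p)
      case 0
      then have "?w = ?y" "?x = 1" using True by simp_all
      then show ?thesis unfolding M using pos min by simp
    next
      case (Suc p')
      have "kfib k p' \<le> ?u" using Suc k by simp
      moreover have "?x = k * ?u + kfib k p'" using Suc by simp
      ultimately have "?x \<le> (k + 1) * ?u" by (simp add: algebra_simps)
      then have xy_le: "?x * ?y \<le> ((k + 1) * ?u) * ?y" using pos by (intro mult_right_mono) auto
      have "?u \<le> ?x" using k by simp
      then have uv_le: "?u * ?v \<le> ?x * ?v" using pos by (intro mult_right_mono) auto
      have uy: "0 \<le> ?u * ?y" "0 \<le> ?u * ?v" using pos by simp_all
      \<comment> \<open>Paired with 3w <= z this gives w^2 <= z(z - 3xy). For k = 3 the gap is xv +
        uy, and xy is at most 4xv and at most 4uy; for k >= 4 the gap already contains xy.\<close>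
      have "?w \<le> 3 * (?z - 3 * ?x * ?y)"
      proof (cases "k = 3")
        case True
        obtain q' where "q = Suc q'" using pq Suc by (cases q) auto
        then have "?y \<le> 4 * ?v" using True k by simp
        then have "?x * ?y \<le> ?x * (4 * ?v)" using pos by (intro mult_left_mono) auto
        then show ?thesis using xy_le uv_le uy True unfolding w z by (simp add: algebra_simps)
      next
        case False
        then have "4 * (?x * ?y) \<le> k * (?x * ?y)" using k3 xy by (intro mult_right_mono) auto
        then show ?thesis using uv_le uy xy unfolding w z by (simp add: algebra_simps)
      qed
      moreover have "3 * ?w \<le> ?z"
        using kfib_mult_le[OF k, of n] mult_right_mono[OF k3 pos(4)] by linarith
      ultimately have "(3 * ?w) * ?w \<le> ?z * (3 * (?z - 3 * ?x * ?y))"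
        using pos by (intro mult_mono) auto
      moreover have "0 \<le> ?x\<^sup>2" "0 \<le> ?y\<^sup>2" by simp_all
      ultimately show ?thesis unfolding M power2_eq_square[of ?w] by linarith
    qed
  qed
qed

section \<open>Two triples sharing the largest component\<close>

text \<open>With D = xy - x'y' > 0, minimality and the equation give 9xyD <= x^2 + y^2. A smaller
  index sum would make D too large for this, and a larger one would make x'y' exceed xy.\<close>

lemma same_max_index_sum:
  assumes k: "k \<ge> 2" and pq: "p \<le> q"
    and min: "3 * kfib k (Suc p) * kfib k (Suc q) \<le> z"
    and eq: "3 * z * (kfib k (Suc p) * kfib k (Suc q) - kfib k (Suc p') * kfib k (Suc q')) =
      (kfib k (Suc p))\<^sup>2 + (kfib k (Suc q))\<^sup>2 - (kfib k (Suc p'))\<^sup>2 - (kfib k (Suc q'))\<^sup>2"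
    and D: "kfib k (Suc p') * kfib k (Suc q') < kfib k (Suc p) * kfib k (Suc q)"
  shows "p' + q' = p + q \<and> p < p'"
proof -
  let ?x = "kfib k (Suc p)" and ?y = "kfib k (Suc q)"
    and ?x' = "kfib k (Suc p')" and ?y' = "kfib k (Suc q')"
  let ?D = "?x * ?y - ?x' * ?y'"
  have pos: "0 < ?x" "0 < ?y" "0 < ?x'" "0 < ?y'" using kfib_pos[OF k] by auto
  have xy: "0 < ?x * ?y" using pos by simp
  have z: "0 < z" using min xy unfolding mult.assoc by linarith
  have "?x \<le> ?y" using k pq by simp
  then have xxyy: "?x\<^sup>2 \<le> ?y\<^sup>2" using pos by (intro power_mono) auto
  have "9 * (?x * ?y) * ?D \<le> 3 * z * ?D"
    using min D by (intro mult_right_mono) auto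
  also have "\<dots> \<le> ?x\<^sup>2 + ?y\<^sup>2"
    unfolding eq using zero_le_power2[of ?x'] zero_le_power2[of ?y'] by linarith
  finally have upper: "9 * (?x * ?y) * ?D \<le> ?x\<^sup>2 + ?y\<^sup>2" .
  have "p' + q' = p + q"
  proof (rule ccontr)
    assume "p' + q' \<noteq> p + q"
    then consider "p' + q' < p + q" | "p + q < p' + q'" by linarith
    then show False
    proof cases
      case 1
      then obtain r where r: "p + q = Suc r" "p' + q' \<le> r" by (cases "p + q") auto
      have "?x' * ?y' \<le> kfib k (Suc (p' + q'))" by (rule kfib_mult_le_add[OF k])
      also have "\<dots> \<le> kfib k (p + q)" using k r by simp
      finally have "8 * (?x' * ?y') \<le> 8 * kfib k (p + q)" by simp
      \<comment> \<open>Hence x'y' is at most 5/8 of xy and D at least 3/8 of it, which yields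
        27x^2y^2 <= 16y^2.\<close>
      also have "\<dots> \<le> 5 * (?x * ?y)"
        using kfib_add_le_mult[OF k, of p q] kfib_double[OF k, of "p + q"] by linarith
      finally have "3 * (?x * ?y) \<le> 8 * ?D" by simp
      then have "9 * (?x * ?y) * (3 * (?x * ?y)) \<le> 9 * (?x * ?y) * (8 * ?D)"
        using xy by (intro mult_left_mono) auto
      also have "\<dots> = 8 * (9 * (?x * ?y) * ?D)" by simp
      also have "\<dots> \<le> 8 * (?x\<^sup>2 + ?y\<^sup>2)"
        by (rule mult_left_mono[OF upper]) simp
      also have "\<dots> \<le> 16 * ?y\<^sup>2" using xxyy by simp
      finally have "27 * (?x\<^sup>2 * ?y\<^sup>2) \<le> 16 * ?y\<^sup>2" by (simp add: power2_eq_square algebra_simps)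
      moreover have "1 * ?y\<^sup>2 \<le> ?x\<^sup>2 * ?y\<^sup>2"
        using pos by (intro mult_right_mono) (auto simp: int_one_le_iff_zero_less)
      moreover have "0 < ?y\<^sup>2" using pos by simp
      ultimately show False by linarith
    next
      case 2
      have "2 * (?x * ?y) \<le> 2 * kfib k (Suc (p + q))" using kfib_mult_le_add[OF k] by simp
      also have "\<dots> \<le> kfib k (Suc (Suc (p + q)))" by (rule kfib_double[OF k])
      also have "\<dots> \<le> kfib k (Suc (p' + q'))" using k 2 by (simp del: kfib.simps)
      finally show False using kfib_add_le_mult[OF k, of p' q'] D xy by linarith
    qed
  qed
  moreover have "p < p'"
  proof (rule ccontr)
    assume "\<not> p < p'"
    moreover have "p \<noteq> p'" using D \<open>p' + q' = p + q\<close> by auto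
    ultimately have "q < q'" using \<open>p' + q' = p + q\<close> by linarith
    \<comment> \<open>The square of y' is then at least 4y^2 > x^2 + y^2, so the right side of the
      equation is negative while the left side is positive.\<close>
    then have "2 * ?y \<le> ?y'"
      using kfib_double[OF k, of "Suc q"] k by (meson Suc_leI Suc_mono kfib_le_iff order_trans)
    then have "(2 * ?y)\<^sup>2 \<le> ?y'\<^sup>2" using pos by (intro power_mono) auto
    moreover have "0 < 3 * z * ?D" using z D by simp
    moreover have "0 < ?y\<^sup>2" "0 < ?x'\<^sup>2" using pos by simp_all
    ultimately show False using eq xxyy by (simp add: power_mult_distrib)
  qed
  ultimately show ?thesis by simp
qed

text \<open>The left side is the companion Lucas number F(r+2) + F(r). Comparison of coefficients
  gives k <= 3; k = 3 forces F(r) = 0, and k = 2 is the equality case of doubling.\<close>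

lemma kfib_quotient_eq_three:
  assumes k: "k \<ge> 2" and eq: "k * kfib k (Suc r) + 2 * kfib k r = 3 * kfib k (Suc r)"
  shows "k = 3 \<and> r = 0 \<or> k = 2 \<and> r = 1"
proof -
  have pos: "0 < kfib k (Suc r)" "0 \<le> kfib k r"
    using kfib_pos[OF k] kfib_nonneg[OF k] by auto
  have "k * kfib k (Suc r) \<le> 3 * kfib k (Suc r)" using eq pos by linarith
  then have "k \<le> 3" using pos by simp
  then consider "k = 2" | "k = 3" using k by linarith
  then show ?thesis
  proof cases
    case 1
    then show ?thesis using kfib_double_eqD[OF k, of r] eq by simp
  next
    case 2
    then have "kfib k r = kfib k 0" using eq by simp
    then show ?thesis using 2 k by (simp del: kfib.simps)
  qed
qed

lemma same_max_index:
  assumes k: "k \<ge> 2" and pq: "p \<le> q" and pq': "p' \<le> q'"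
    and min: "3 * kfib k (Suc p) * kfib k (Suc q) \<le> kfib k c"
    and eq: "3 * kfib k c * (kfib k (Suc p) * kfib k (Suc q) - kfib k (Suc p') * kfib k (Suc q')) =
      (kfib k (Suc p))\<^sup>2 + (kfib k (Suc q))\<^sup>2 - (kfib k (Suc p'))\<^sup>2 - (kfib k (Suc q'))\<^sup>2"
    and D: "kfib k (Suc p') * kfib k (Suc q') < kfib k (Suc p) * kfib k (Suc q)"
  shows "k = 3 \<and> even p \<and> odd q \<and> p + 3 \<le> q \<and> p' = Suc p \<and> q = Suc q' \<and> c = Suc (Suc (p + q))"
proof -
  let ?x = "kfib k (Suc p)" and ?y = "kfib k (Suc q)"
    and ?x' = "kfib k (Suc p')" and ?y' = "kfib k (Suc q')"
  have sum: "p' + q' = p + q" and pp': "p < p'"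
    using same_max_index_sum[OF k pq min eq D] by auto
  \<comment> \<open>The differences p' - p and q' - p are \<open>Suc r\<close> and
    \<open>Suc d\<close>, while \<open>n\<close> is q' - p'. With a = p+1 and b = q+1,
    \<open>s\<close> is a + b.\<close>
  define r where "r = p' - Suc p"
  define n where "n = q' - p'"
  define d where "d = n + r"
  define s where "s = Suc (Suc (p + q))"
  have p': "p' = p + Suc r" and q': "q' = p + Suc d" and q: "q = p + Suc r + Suc d"
    using sum pp' pq' by (auto simp: r_def n_def d_def)
  have pos: "0 < kfib k (Suc i)" "0 \<le> kfib k i" for i
    using kfib_pos[OF k] kfib_nonneg[OF k] by auto
  have Vajda: "?x' * ?y' - ?x * ?y = (-1) ^ Suc p * (kfib k (Suc r) * kfib k (Suc d))"
    using kfib_Vajda[of k "Suc p" "Suc r" "Suc d"] unfolding p' q' q by (simp del: kfib.simps add: add_ac)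
  have "even p"
  proof (rule ccontr)
    assume "odd p"
    then have "?x' * ?y' - ?x * ?y = kfib k (Suc r) * kfib k (Suc d)" using Vajda by simp
    then show False using D pos mult_pos_pos by (smt (verit))
  qed
  then have D_eq: "?x * ?y - ?x' * ?y' = kfib k (Suc r) * kfib k (Suc d)" using Vajda by simp
  \<comment> \<open>If c > s, two uses of the factor 5/4 bound F(c)D below by 16/25 of F(2q+1) = y^2
    + F(q)^2, since s + r + d = 2q. Three times this exceeds x^2 + y^2.\<close>
  have cs: "c = s"
  proof (rule ccontr)
    assume "c \<noteq> s"
    then have "Suc s \<le> c" using minimal_index_ge[OF k min] by (simp add: s_def)
    then have "kfib k (Suc s) \<le> kfib k c" using k by simp
    then have "kfib k (Suc s) * (kfib k (Suc r) * kfib k (Suc d)) \<le>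
        kfib k c * (kfib k (Suc r) * kfib k (Suc d))"
      using pos by (intro mult_right_mono) (auto intro: less_imp_le)
    moreover have "4 * (kfib k (Suc s) * kfib k (Suc (r + d))) \<le>
        5 * (kfib k (Suc s) * (kfib k (Suc r) * kfib k (Suc d)))"
      using mult_left_mono[OF kfib_add_le_mult[OF k, of r d] pos(2)[of "Suc s"]]
      by (simp only: mult.left_commute[of "kfib k (Suc s)"])
    moreover have "4 * kfib k (Suc (q + q)) \<le> 5 * (kfib k (Suc s) * kfib k (Suc (r + d)))"
      using kfib_add_le_mult[OF k, of s "r + d"] unfolding s_def q
      by (simp add: add_ac del: kfib.simps)
    moreover have "kfib k (Suc (q + q)) = ?y\<^sup>2 + (kfib k q)\<^sup>2"
      using kfib_add[of k q q] by (simp add: power2_eq_square)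
    moreover have "?x\<^sup>2 \<le> (kfib k q)\<^sup>2"
      using k q pos by (intro power_mono) (auto simp del: kfib.simps)
    moreover have "0 < ?x'\<^sup>2" "0 < ?y'\<^sup>2" "0 < ?x\<^sup>2"
      by (rule zero_less_power[OF pos(1)])+
    ultimately show False using eq zero_le_power2[of ?y] unfolding D_eq mult.assoc by linarith
  qed
  have s1: "2 * Suc p + (Suc r + Suc d) = s" and s2: "2 * Suc p' + n = s"
    by (auto simp: s_def q p' d_def)
  have y: "Suc q = Suc p + (Suc r + Suc d)" and y': "Suc q' = Suc p' + n"
    by (auto simp: q q' p' d_def)
  have e: "Suc r + Suc d = n + 2 * Suc r" by (simp add: d_def)
  have "odd n"
  proof
    assume "even n"
    then have "?y\<^sup>2 - ?x\<^sup>2 = kfib k (n + 2 * Suc r) * kfib k s" "?y'\<^sup>2 - ?x'\<^sup>2 = kfib k n * kfib k s"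
      using kfib_diff_of_squares[of "Suc r + Suc d" k "Suc p"] kfib_diff_of_squares[of n k "Suc p'"]
      unfolding s1 s2 y[symmetric] y'[symmetric] unfolding e by simp_all
    \<comment> \<open>Uses x^2 + y^2 - x'^2 - y'^2 = (y^2 - x^2) - (y'^2 - x'^2) - 2(x'^2 - x^2),
      where the first two differences are multiples of F(s).\<close>
    then have "2 * (?x'\<^sup>2 - ?x\<^sup>2) =
        kfib k s * (kfib k (n + 2 * Suc r) - kfib k n - 3 * (kfib k (Suc r) * kfib k (Suc d)))"
      using eq unfolding D_eq cs by (simp add: algebra_simps del: kfib.simps)
    then have "kfib k s dvd 2 * (?x'\<^sup>2 - ?x\<^sup>2)" by simp
    moreover have "?x\<^sup>2 < ?x'\<^sup>2" using k pp' pos by (intro power_strict_mono) auto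
    moreover have "2 * (?x'\<^sup>2 - ?x\<^sup>2) < kfib k s"
    proof -
      have "2 * (?x'\<^sup>2 - ?x\<^sup>2) < 2 * ?x'\<^sup>2" using pos(1)[of p] by (simp del: kfib.simps)
      also have "\<dots> \<le> 2 * kfib k (Suc (p' + p'))"
        using kfib_mult_le_add[OF k, of p' p'] by (simp add: power2_eq_square)
      also have "\<dots> \<le> kfib k (Suc (Suc (p' + p')))" by (rule kfib_double[OF k])
      also have "\<dots> \<le> kfib k s" using k pq' sum by (simp add: s_def del: kfib.simps)
      finally show ?thesis .
    qed
    ultimately show False using zdvd_not_zless[of "2 * (?x'\<^sup>2 - ?x\<^sup>2)" "kfib k s"] by simp
  qed
  then have "?x\<^sup>2 + ?y\<^sup>2 = kfib k (n + 2 * Suc r) * kfib k s" "?x'\<^sup>2 + ?y'\<^sup>2 = kfib k n * kfib k s"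
    using kfib_sum_of_squares[of "Suc r + Suc d" k "Suc p"] kfib_sum_of_squares[of n k "Suc p'"]
    unfolding s1 s2 y[symmetric] y'[symmetric] unfolding e by simp_all
  then have "kfib k s * (3 * (kfib k (Suc r) * kfib k (Suc d))) =
      kfib k s * (kfib k (n + 2 * Suc r) - kfib k n)"
    using eq unfolding D_eq cs by (simp add: algebra_simps del: kfib.simps)
  moreover have "kfib k s \<noteq> 0" using pos(1)[of "Suc (p + q)"] by (simp add: s_def)
  ultimately have key: "3 * (kfib k (Suc r) * kfib k (Suc d)) = kfib k (n + 2 * Suc r) - kfib k n"
    by (simp del: kfib.simps)
  have nd: "n + Suc r = Suc d" by (simp add: d_def)
  \<comment> \<open>For even \<open>r\<close> the factor F(d+1) cancels, and parity rules out r = 1.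
    For odd \<open>r\<close> the factor F(r+1) cancels instead, leaving the same equation at index
    \<open>d\<close>, which is even and positive: no solution.\<close>
  have "k = 3 \<and> r = 0"
  proof (cases "even r")
    case True
    then have "kfib k (Suc d) * (k * kfib k (Suc r) + 2 * kfib k r) = kfib k (Suc d) * (3 * kfib k (Suc r))"
      using key kfib_shift_odd[of r k n] unfolding nd by (simp add: algebra_simps)
    then have "k * kfib k (Suc r) + 2 * kfib k r = 3 * kfib k (Suc r)" using pos(1)[of d] by simp
    from kfib_quotient_eq_three[OF k this] True show ?thesis by auto
  next
    case False
    then have "kfib k (Suc r) * (k * kfib k (Suc d) + 2 * kfib k d) = kfib k (Suc r) * (3 * kfib k (Suc d))"
      using key kfib_shift_even[of "Suc r" k n] unfolding nd by (simp add: algebra_simps)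
    then have "k * kfib k (Suc d) + 2 * kfib k d = 3 * kfib k (Suc d)" using pos(1)[of r] by simp
    moreover have "even d" "d \<noteq> 0" using False \<open>odd n\<close> by (auto simp: d_def)
    ultimately show ?thesis using kfib_quotient_eq_three[OF k, of d] by fastforce
  qed
  \<comment> \<open>With r = 0 one has q = p + n + 2, so this supplies
    \<open>p + 3 \<le> q\<close>.\<close>
  moreover have "n \<noteq> 0" using \<open>odd n\<close> by (rule contrapos_nn) simp
  ultimately show ?thesis using \<open>even p\<close> \<open>odd n\<close> cs p' q q' by (auto simp: d_def s_def)
qed

section \<open>Comparison of arbitrary minimal triples with the same m\<close>

text \<open>If n < n', the common value would be below F(n+1)^2 <= F(n')^2 and yet at least
  F(n')^2.\<close>

lemma max_index_le:
  fixes k :: int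
  defines "F \<equiv> kfib k"
  assumes k: "k \<ge> 2" and pq: "p \<le> q" and pq': "p' \<le> q'"
    and min: "3 * F (Suc p) * F (Suc q) \<le> F (Suc n)"
    and min': "3 * F (Suc p') * F (Suc q') \<le> F (Suc n')"
    and val: "(F (Suc p))\<^sup>2 + (F (Suc q))\<^sup>2 + (F (Suc n))\<^sup>2 - 3 * F (Suc p) * F (Suc q) * F (Suc n) =
      (F (Suc p'))\<^sup>2 + (F (Suc q'))\<^sup>2 + (F (Suc n'))\<^sup>2 - 3 * F (Suc p') * F (Suc q') * F (Suc n')"
  shows "n' \<le> n"
proof (rule ccontr)
  assume "\<not> n' \<le> n"
  then have nn': "n < n'" by simp
  have index: "Suc (Suc (p + q)) \<le> Suc n" using minimal_index_ge[OF k] min unfolding F_def by blast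
  show False
  proof (cases "k = 2 \<and> p' = 1 \<and> q' = 1 \<and> n' = 3")
    case True
    then have "n \<le> 2" using nn' by simp
    \<comment> \<open>The candidates below (2,2,12) are (1,1,2) and (1,2,5), which are not minimal,
      and (1,1,5), whose value is 12 instead of 8.\<close>
    then have "p = 0" "q = 0 \<and> (n = 1 \<or> n = 2) \<or> q = 1 \<and> n = 2" using index pq by auto
    then show False using True min val by (auto simp: F_def numeral_eq_Suc)
  next
    case False
    have "F (Suc n) \<le> F n'" using nn' k unfolding F_def by (simp del: kfib.simps)
    then have "(F (Suc n))\<^sup>2 \<le> (F n')\<^sup>2"
      using kfib_nonneg[OF k] unfolding F_def by (intro power_mono)
    also have "\<dots> \<le> (F (Suc p))\<^sup>2 + (F (Suc q))\<^sup>2 + (F (Suc n))\<^sup>2 - 3 * F (Suc p) * F (Suc q) * F (Suc n)"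
      using markoff_ge_square[OF k pq' min'[unfolded F_def] False] val unfolding F_def by simp
    also have "\<dots> < (F (Suc n))\<^sup>2"
      using index k pq kfib_pos[OF k] unfolding F_def
      by (intro markoff_less_square) (simp_all del: kfib.simps)
    finally show False by simp
  qed
qed

lemma minimal_kfib_tripleE:
  assumes "k \<ge> 2" "minimal_markoff_triple m S" "kfib_components k S"
  obtains p q n where "S = (kfib k (Suc p), kfib k (Suc q), kfib k (Suc n))" "p \<le> q"
    "3 * kfib k (Suc p) * kfib k (Suc q) \<le> kfib k (Suc n)"
    "(kfib k (Suc p))\<^sup>2 + (kfib k (Suc q))\<^sup>2 + (kfib k (Suc n))\<^sup>2
      - 3 * kfib k (Suc p) * kfib k (Suc q) * kfib k (Suc n) = m"
proof -
  from assms(3) obtain a b c where abc: "a > 0" "b > 0" "c > 0"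
    "S = (kfib k a, kfib k b, kfib k c)" unfolding kfib_components_def by blast
  then obtain p q n where "a = Suc p" "b = Suc q" "c = Suc n" by (meson gr0_implies_Suc)
  with abc assms(1,2) show thesis
    by (intro that[of p q n])
      (simp_all add: minimal_markoff_triple_def ordered_markoff_triple_def markoff_triple_def
        del: kfib.simps)
qed

text \<open>The assumption \<open>le\<close> fixes the order of the two triples by the product of
  their smaller components; the final theorem applies this in both orders.\<close>

lemma distinct_minimal_kfib_triples:
  assumes k: "k \<ge> 2"
    and S: "minimal_markoff_triple m S" "kfib_components k S"
    and T: "minimal_markoff_triple m T" "kfib_components k T"
    and le: "fst T * fst (snd T) \<le> fst S * fst (snd S)" and ne: "S \<noteq> T"
  shows "k = 3 \<and> (\<exists>a b. a \<ge> 1 \<and> odd a \<and> even b \<and> b \<ge> a + 3 \<and>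
      S = (kfib 3 a, kfib 3 b, kfib 3 (a + b)) \<and>
      T = (kfib 3 (a + 1), kfib 3 (b - 1), kfib 3 (a + b)))"
proof -
  obtain p q n where S_eq: "S = (kfib k (Suc p), kfib k (Suc q), kfib k (Suc n))" and pq: "p \<le> q"
    and min: "3 * kfib k (Suc p) * kfib k (Suc q) \<le> kfib k (Suc n)"
    and m: "(kfib k (Suc p))\<^sup>2 + (kfib k (Suc q))\<^sup>2 + (kfib k (Suc n))\<^sup>2
      - 3 * kfib k (Suc p) * kfib k (Suc q) * kfib k (Suc n) = m"
    using minimal_kfib_tripleE[OF k S] .
  obtain p' q' n' where T_eq: "T = (kfib k (Suc p'), kfib k (Suc q'), kfib k (Suc n'))" and pq': "p' \<le> q'"
    and min': "3 * kfib k (Suc p') * kfib k (Suc q') \<le> kfib k (Suc n')"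
    and m': "(kfib k (Suc p'))\<^sup>2 + (kfib k (Suc q'))\<^sup>2 + (kfib k (Suc n'))\<^sup>2
      - 3 * kfib k (Suc p') * kfib k (Suc q') * kfib k (Suc n') = m"
    using minimal_kfib_tripleE[OF k T] .
  let ?x = "kfib k (Suc p)" and ?y = "kfib k (Suc q)" and ?z = "kfib k (Suc n)"
    and ?x' = "kfib k (Suc p')" and ?y' = "kfib k (Suc q')"
  have "n = n'"
    using max_index_le[OF k pq pq' min min'] max_index_le[OF k pq' pq min' min] m m'
    by (intro antisym) simp_all
  then have eq: "3 * ?z * (?x * ?y - ?x' * ?y') = ?x\<^sup>2 + ?y\<^sup>2 - ?x'\<^sup>2 - ?y'\<^sup>2"
    using m m' by (simp add: algebra_simps del: kfib.simps)
  have "?x' * ?y' \<noteq> ?x * ?y"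
  proof
    assume prod: "?x' * ?y' = ?x * ?y"
    then have sq: "?x\<^sup>2 + ?y\<^sup>2 = ?x'\<^sup>2 + ?y'\<^sup>2" using eq by simp
    \<comment> \<open>Equal products and equal sums of squares determine the sum and the difference,
      so the two triples would coincide.\<close>
    have "(?x + ?y)\<^sup>2 = (?x' + ?y')\<^sup>2" "(?y - ?x)\<^sup>2 = (?y' - ?x')\<^sup>2"
      using prod sq by (simp_all add: power2_sum power2_diff algebra_simps)
    moreover have "?x \<le> ?y" "?x' \<le> ?y'" using k pq pq' by (simp_all del: kfib.simps)
    moreover have "0 < ?x" "0 < ?y" "0 < ?x'" "0 < ?y'" using kfib_pos[OF k] by auto
    ultimately have "?x + ?y = ?x' + ?y'" "?y - ?x = ?y' - ?x'"
      by (simp_all add: power2_eq_iff_nonneg del: kfib.simps)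
    then show False using ne S_eq T_eq \<open>n = n'\<close> by simp
  qed
  then have "?x' * ?y' < ?x * ?y" using le S_eq T_eq by simp
  from same_max_index[OF k pq pq' min eq this]
  have *: "k = 3" "even p" "odd q" "p + 3 \<le> q" "p' = Suc p" "q = Suc q'" "Suc n = Suc p + Suc q"
    by auto
  show ?thesis
    using * S_eq T_eq \<open>n = n'\<close>
    by (intro conjI exI[of _ "Suc p"] exI[of _ "Suc q"]) (simp_all del: kfib.simps)
qed

section \<open>The exceptional family for k = 3\<close>

lemma minimal_kfib_three:
  assumes "0 < a" "a \<le> b"
  shows "3 * kfib 3 a * kfib 3 b \<le> kfib 3 (a + b)"
proof -
  obtain p q where "a = Suc p" "b = Suc q" using assms by (meson gr0_implies_Suc order_less_le_trans)
  then show ?thesis using kfib_add_Suc[of 3 p q] kfib_nonneg[of 3] by simp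
qed

lemma minimal_markoff_tripleI:
  assumes "0 < x" "x \<le> y" "y \<le> z" "3 * x * y \<le> z" "x\<^sup>2 + y\<^sup>2 + z\<^sup>2 - 3 * x * y * z = m"
  shows "minimal_markoff_triple m (x, y, z)"
  using assms
  by (simp add: minimal_markoff_triple_def ordered_markoff_triple_def markoff_triple_def)

text \<open>For e = b - a - 2, which is odd, the sums of squares are F(e+2)z and F(e)z, and the
  products differ by F(e+1). The values agree because F(e+2) - F(e) = 3F(e+1).\<close>

lemma kfib_three_pair:
  assumes a: "a \<ge> 1" "odd a" and b: "even b" "b \<ge> a + 3"
  shows "(kfib 3 a, kfib 3 b, kfib 3 (a + b)) \<noteq> (kfib 3 (a + 1), kfib 3 (b - 1), kfib 3 (a + b))"
    and "\<exists>m>0. minimal_markoff_triple m (kfib 3 a, kfib 3 b, kfib 3 (a + b)) \<and>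
      minimal_markoff_triple m (kfib 3 (a + 1), kfib 3 (b - 1), kfib 3 (a + b))"
proof -
  let ?x = "kfib 3 a" and ?y = "kfib 3 b" and ?z = "kfib 3 (a + b)"
    and ?x' = "kfib 3 (a + 1)" and ?y' = "kfib 3 (b - 1)"
  show "(?x, ?y, ?z) \<noteq> (?x', ?y', ?z)" by simp
  define e where "e = b - a - 2"
  have b_eq: "b = a + 1 + Suc e" and "odd e" using a b by (auto simp: e_def)
  have pos: "0 < kfib 3 i" if "0 < i" for i using kfib_pos[of 3 "i - 1"] that by simp
  have min: "3 * ?x * ?y \<le> ?z" using minimal_kfib_three[of a b] a b by simp
  have min': "3 * ?x' * ?y' \<le> ?z" using minimal_kfib_three[of "a + 1" "b - 1"] a b by simp
  have prod: "?x * ?y - ?x' * ?y' = kfib 3 (Suc e)"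
    using kfib_Vajda[of 3 a 1 "Suc e"] a unfolding b_eq by simp
  have "?x\<^sup>2 + ?y\<^sup>2 = kfib 3 (Suc (Suc e)) * ?z" "?x'\<^sup>2 + ?y'\<^sup>2 = kfib 3 e * ?z"
    using kfib_sum_of_squares[of "Suc (Suc e)" 3 a] kfib_sum_of_squares[of e 3 "a + 1"] \<open>odd e\<close>
    unfolding b_eq by (simp_all add: add_ac mult_2 del: kfib.simps)
  then have "?x\<^sup>2 + ?y\<^sup>2 - ?x'\<^sup>2 - ?y'\<^sup>2 = 3 * ?z * kfib 3 (Suc e)"
    by (simp add: algebra_simps)
  then have eq: "?x\<^sup>2 + ?y\<^sup>2 + ?z\<^sup>2 - 3 * ?x * ?y * ?z = ?x'\<^sup>2 + ?y'\<^sup>2 + ?z\<^sup>2 - 3 * ?x' * ?y' * ?z"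
    unfolding prod[symmetric] by (simp add: algebra_simps)
  \<comment> \<open>Positivity of m follows from m = x^2 + y^2 + z(z - 3xy).\<close>
  have "0 \<le> ?z * (?z - 3 * ?x * ?y)" using min pos[of "a + b"] a by simp
  moreover have "0 < ?x\<^sup>2" using pos[of a] a by simp
  moreover have "0 \<le> ?y\<^sup>2" by simp
  ultimately have "0 < ?x\<^sup>2 + ?y\<^sup>2 + ?z * (?z - 3 * ?x * ?y)" by (intro add_pos_nonneg)
  then have "0 < ?x\<^sup>2 + ?y\<^sup>2 + ?z\<^sup>2 - 3 * ?x * ?y * ?z"
    by (simp add: power2_eq_square algebra_simps)
  moreover have "minimal_markoff_triple (?x\<^sup>2 + ?y\<^sup>2 + ?z\<^sup>2 - 3 * ?x * ?y * ?z) (?x, ?y, ?z)"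
    using a b pos[of a] min by (intro minimal_markoff_tripleI) auto
  moreover have "minimal_markoff_triple (?x\<^sup>2 + ?y\<^sup>2 + ?z\<^sup>2 - 3 * ?x * ?y * ?z) (?x', ?y', ?z)"
    using a b pos[of "a + 1"] min' eq by (intro minimal_markoff_tripleI) auto
  ultimately show "\<exists>m>0. minimal_markoff_triple m (?x, ?y, ?z) \<and> minimal_markoff_triple m (?x', ?y', ?z)"
    by blast
qed

theorem theorem1p2:
  shows "(\<forall>(k::int) (m::int) (S::int \<times> int \<times> int) (T::int \<times> int \<times> int).
            k \<ge> 2 \<and> m > 0 \<and>
            minimal_markoff_triple m S \<and> kfib_components k S \<and>
            minimal_markoff_triple m T \<and> kfib_components k T \<and> S \<noteq> T \<longrightarrow>
            k = 3 \<and>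
            (\<exists>(a::nat) (b::nat). a \<ge> 1 \<and> odd a \<and> even b \<and> b \<ge> a + 3 \<and>
               {S, T} = {(kfib 3 a, kfib 3 b, kfib 3 (a + b)),
                         (kfib 3 (a + 1), kfib 3 (b - 1), kfib 3 (a + b))}))
       \<and>
         (\<forall>(a::nat) (b::nat). a \<ge> 1 \<and> odd a \<and> even b \<and> b \<ge> a + 3 \<longrightarrow>
            (kfib 3 a, kfib 3 b, kfib 3 (a + b)) \<noteq>
              (kfib 3 (a + 1), kfib 3 (b - 1), kfib 3 (a + b)) \<and>
            (\<exists>m::int. m > 0 \<and>
               minimal_markoff_triple m (kfib 3 a, kfib 3 b, kfib 3 (a + b)) \<and>
               minimal_markoff_triple m (kfib 3 (a + 1), kfib 3 (b - 1), kfib 3 (a + b))))"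
proof (intro conjI allI impI)
  fix k m :: int and S T :: "int \<times> int \<times> int"
  assume H: "k \<ge> 2 \<and> m > 0 \<and>
    minimal_markoff_triple m S \<and> kfib_components k S \<and>
    minimal_markoff_triple m T \<and> kfib_components k T \<and> S \<noteq> T"
  let ?pair = "\<lambda>S T a b. a \<ge> 1 \<and> odd a \<and> even b \<and> b \<ge> a + 3 \<and>
    S = (kfib 3 a, kfib 3 b, kfib 3 (a + b)) \<and>
    T = (kfib 3 (a + 1), kfib 3 (b - 1), kfib 3 (a + b))"
  have "k = 3 \<and> (\<exists>a b. ?pair S T a b \<or> ?pair T S a b)"
    using H distinct_minimal_kfib_triples[of k m S T] distinct_minimal_kfib_triples[of k m T S]
      linear[of "fst T * fst (snd T)" "fst S * fst (snd S)"] by metis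
  then show "k = 3" and "\<exists>(a::nat) (b::nat). a \<ge> 1 \<and> odd a \<and> even b \<and> b \<ge> a + 3 \<and>
    {S, T} = {(kfib 3 a, kfib 3 b, kfib 3 (a + b)),
              (kfib 3 (a + 1), kfib 3 (b - 1), kfib 3 (a + b))}"
    by blast+
next
  fix a b :: nat
  assume "a \<ge> 1 \<and> odd a \<and> even b \<and> b \<ge> a + 3"
  then show "(kfib 3 a, kfib 3 b, kfib 3 (a + b)) \<noteq>
      (kfib 3 (a + 1), kfib 3 (b - 1), kfib 3 (a + b))"
    and "\<exists>m::int. m > 0 \<and>
      minimal_markoff_triple m (kfib 3 a, kfib 3 b, kfib 3 (a + b)) \<and>
      minimal_markoff_triple m (kfib 3 (a + 1), kfib 3 (b - 1), kfib 3 (a + b))"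
    using kfib_three_pair[of a b] by blast+
qed

end
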